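(* Let $G$ be a $d$-regular graph, $d\geq 7$, with no cycle of length $4$, such that there exists a vertex $x$ of $G$ with $N(x)=\{x_1,\dots,x_d\}$ satisfying the following two conditions: (1) for every $i$ with $1\leq i\leq d$, $$\Big|\Big\{v\in N(x_i) : N(v)\cap \bigcup_{j\neq i} N(x_j)\neq\emptyset\Big\}\Big|\leq \Big\lceil \frac{d-1}{2}\Big\rceil-1;$$ (2) for every $i$ with $1\leq i\leq d$ and every $v\in N(x_i)$, $$\Big|N(v)\cap \bigcup_{j\neq i} N(x_j)\Big|\leq \Big\lceil \frac{d-1}{2}\Big\rceil-1.$$ Here the unions are over all $j\in\{1,\dots,d\}$ with $j\ne i$. Then $b(G)=d+1$.
   Context: Graphs are finite and simple. $N(v)$ denotes the set of neighbors of the vertex $v$ in $G$. Having no cycle of length $4$ means having no such cycle as a (not necessarily induced) subgraph. In a proper vertex coloring of a graph, a vertex of color $i$ is called dominant if it has a neighbor in each color class distinct from $i$. A $b$-coloring is a proper coloring in which each color class contains at least one dominant vertex. The $b$-chromatic number $b(G)$ is the largest positive integer $k$ such that $G$ has a $b$-coloring with $k$ colors. *)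

theory Defs
  imports Complex_Main "Graph_Theory.Graph_Theory"
begin

text \<open>Finite simple graphs are the library's \<open>pair_graph\<close>: finite, loop-free, with a symmetric arc
  relation, so that an edge \<open>uv\<close> is represented by the two arcs \<open>(u, v)\<close> and \<open>(v, u)\<close>.\<close>

definition nbrs :: "'a pair_pre_digraph \<Rightarrow> 'a \<Rightarrow> 'a set" where
  "nbrs G v = {w. (v, w) \<in> parcs G}"

definition regular :: "'a pair_pre_digraph \<Rightarrow> nat \<Rightarrow> bool" where
  "regular G d \<longleftrightarrow> (\<forall>v\<in>pverts G. card (nbrs G v) = d)"

text \<open>The library's \<open>cycle\<close> is a closed arc walk without repeated vertices. It also admits the
  walk \<open>u, v, u\<close> along a single edge, which is irrelevant for length 4.\<close>

definition has_4_cycle :: "'a pair_pre_digraph \<Rightarrow> bool" where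
  "has_4_cycle G \<longleftrightarrow> (\<exists>p. pre_digraph.cycle (with_proj G) p \<and> length p = 4)"

definition proper_coloring :: "'a pair_pre_digraph \<Rightarrow> ('a \<Rightarrow> nat) \<Rightarrow> bool" where
  "proper_coloring G c \<longleftrightarrow> (\<forall>u\<in>pverts G. \<forall>v\<in>nbrs G u. c u \<noteq> c v)"

definition dominant :: "'a pair_pre_digraph \<Rightarrow> ('a \<Rightarrow> nat) \<Rightarrow> 'a \<Rightarrow> bool" where
  "dominant G c v \<longleftrightarrow> (\<forall>j \<in> c ` pverts G - {c v}. \<exists>w\<in>nbrs G v. c w = j)"

text \<open>The first conjunct says that exactly the colors \<open>1, \<dots>, k\<close> occur, i.e. that all
  \<open>k\<close> color classes are nonempty.\<close>

definition b_coloring :: "'a pair_pre_digraph \<Rightarrow> nat \<Rightarrow> ('a \<Rightarrow> nat) \<Rightarrow> bool" where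
  "b_coloring G k c \<longleftrightarrow> c ` pverts G = {1..k} \<and> proper_coloring G c \<and>
     (\<forall>i\<in>{1..k}. \<exists>v\<in>pverts G. c v = i \<and> dominant G c v)"

definition b_chromatic_number :: "'a pair_pre_digraph \<Rightarrow> nat" where
  "b_chromatic_number G = Max {k. 0 < k \<and> (\<exists>c. b_coloring G k c)}"

lemma finite_b_coloring_sizes:
  assumes "pair_graph G"
  shows "finite {k. 0 < k \<and> (\<exists>c. b_coloring G k c)}"
proof -
  interpret pair_graph G by fact
  have "k \<le> card (pverts G)" if "b_coloring G k c" for k c
    using that card_image_le[OF pair_finite_verts, of c] by (simp add: b_coloring_def)
  then show ?thesis
    by (intro finite_subset[OF _ finite_atMost[of "card (pverts G)"]]) auto
qed

lemma has_4_cycle_iff: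
  assumes "pair_graph G"
  shows "has_4_cycle G \<longleftrightarrow> (\<exists>a b c d. distinct [a, b, c, d] \<and>
    b \<in> nbrs G a \<and> c \<in> nbrs G b \<and> d \<in> nbrs G c \<and> a \<in> nbrs G d)"
    (is "_ \<longleftrightarrow> ?R")
proof
  interpret pair_graph G by fact
  {
    assume "has_4_cycle G"
    then obtain p where p: "cycle p" "length p = 4"
      unfolding has_4_cycle_def by blast
    then obtain e1 e2 e3 e4 where "p = [e1, e2, e3, e4]"
      by (auto simp: numeral_eq_Suc length_Suc_conv)
    then show ?R
      using p(1) unfolding cycle_def awalk_def nbrs_def
      by (cases e1; cases e2; cases e3; cases e4) fastforce
  next
    assume ?R
    then obtain a b c d where *: "distinct [a, b, c, d]" "b \<in> nbrs G a" "c \<in> nbrs G b"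
      "d \<in> nbrs G c" "a \<in> nbrs G d"
      by blast
    then have "cycle [(a, b), (b, c), (c, d), (d, a)]"
      unfolding cycle_def awalk_def nbrs_def
      by (intro exI[of _ a]) (auto dest: arc_fst_in_verts)
    then show "has_4_cycle G"
      unfolding has_4_cycle_def by (intro exI[of _ "[(a, b), (b, c), (c, d), (d, a)]"]) simp
  }
qed

end

theory Submission
  imports Defs
begin

text \<open>A dominant vertex of degree \<open>d\<close> sees at most \<open>d\<close> colors besides its own, so no
  b-coloring of a \<open>d\<close>-regular graph has more than \<open>d + 1\<close> colors. To reach \<open>d + 1\<close>, the closed
  neighborhood of \<open>x\<close> is made to consist of dominant vertices of pairwise different colors: \<open>x\<close>
  gets the color \<open>d + 1\<close>, its neighbor \<open>x\<^sub>i\<close> gets the color \<open>i\<close>, and the \<open>d - 1\<close> vertices of the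
  branch \<open>S\<^sub>i = N(x\<^sub>i) - {x}\<close> get each of the colors in \<open>{1..d} - {i}\<close> exactly once.

  This is a proper coloring of the ball of radius 2 around \<open>x\<close> as soon as the edges between
  different branches are properly colored. Indeed, condition (1) implies that \<open>x\<close> lies in no
  triangle: if \<open>x\<^sub>i\<close> and \<open>x\<^sub>j\<close> were adjacent, then \<open>x\<^sub>i \<in> N(v) \<inter> N(x\<^sub>j)\<close> for all \<open>d\<close> vertices
  \<open>v \<in> N(x\<^sub>i)\<close>. And the branches are disjoint, because a common vertex of \<open>S\<^sub>i\<close> and \<open>S\<^sub>j\<close> would
  close a 4-cycle through \<open>x\<close>.

  Call a vertex of a branch crossing if it has a neighbor in another branch. The two conditions
  bound by \<open>m \<le> (d - 2) / 2\<close> both the number of crossing vertices in a branch and the number of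
  neighbors that a crossing vertex has in other branches. So a crossing vertex of \<open>S\<^sub>i\<close> must avoid
  at most \<open>(m - 1) + m < d - 1\<close> of the \<open>d - 1\<close> colors in \<open>{1..d} - {i}\<close>, and all crossing vertices
  can be colored greedily. The other vertices of \<open>S\<^sub>i\<close> take the remaining colors in any order
  (\<open>branch_coloring\<close>). Finally, the rest of the graph is colored greedily, which is possible with
  \<open>d + 1\<close> colors when all degrees are \<open>d\<close> (\<open>extend_proper_coloring\<close>).\<close>

section \<open>Greedy coloring\<close>

text \<open>Restricting to a subset of \<open>W\<close> only removes conflicts, so the vertices can be colored one
  after the other.\<close>

lemma greedy_list_coloring:
  assumes "finite W"
    and "\<And>v w. R v w \<Longrightarrow> R w v"
    and "\<And>v. v \<in> W \<Longrightarrow> \<not> R v v"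
    and "\<And>v. v \<in> W \<Longrightarrow> card {w \<in> W. R v w} < card (P v)"
  shows "\<exists>f. (\<forall>v\<in>W. f v \<in> P v) \<and> (\<forall>v\<in>W. \<forall>w\<in>W. R v w \<longrightarrow> f v \<noteq> f w)"
  using assms
proof (induction W rule: finite_induct)
  case empty
  then show ?case by simp
next
  case (insert a F)
  have "card {w \<in> F. R v w} < card (P v)" if "v \<in> F" for v
  proof -
    have "card {w \<in> F. R v w} \<le> card {w \<in> insert a F. R v w}"
      using insert.hyps by (intro card_mono) auto
    then show ?thesis using insert.prems(3)[of v] that by simp
  qed
  then have "\<exists>f. (\<forall>v\<in>F. f v \<in> P v) \<and> (\<forall>v\<in>F. \<forall>w\<in>F. R v w \<longrightarrow> f v \<noteq> f w)"
    using insert.prems(1,2) by (intro insert.IH) auto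
  then obtain f where f: "\<forall>v\<in>F. f v \<in> P v"
    "\<forall>v\<in>F. \<forall>w\<in>F. R v w \<longrightarrow> f v \<noteq> f w"
    by (elim exE conjE)
  have "card (f ` {w \<in> F. R a w}) \<le> card {w \<in> F. R a w}"
    using insert.hyps by (intro card_image_le) auto
  also have "\<dots> \<le> card {w \<in> insert a F. R a w}"
    using insert.hyps by (intro card_mono) auto
  also have "\<dots> < card (P a)" using insert.prems(3) by simp
  finally have "\<not> P a \<subseteq> f ` {w \<in> F. R a w}"
    using insert.hyps(1) card_mono[of "f ` {w \<in> F. R a w}" "P a"] by (auto simp: not_less[symmetric])
  then obtain p where p: "p \<in> P a" "p \<notin> f ` {w \<in> F. R a w}" by blast
  have "p \<noteq> f w" if "w \<in> F" "R a w \<or> R w a" for w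
    using p(2) that insert.prems(1) by blast
  then have "\<forall>v\<in>insert a F. \<forall>w\<in>insert a F. R v w \<longrightarrow> (f(a := p)) v \<noteq> (f(a := p)) w"
    using f(2) insert.hyps(2) insert.prems(2)[of a] by auto
  moreover have "\<forall>v\<in>insert a F. (f(a := p)) v \<in> P v"
    using f p insert.hyps(2) by auto
  ultimately show ?case by blast
qed

lemma finite_nbrs:
  assumes "pair_graph G"
  shows "finite (nbrs G v)"
proof -
  interpret pair_graph G by fact
  have "nbrs G v \<subseteq> snd ` parcs G" by (force simp: nbrs_def)
  then show ?thesis using finite_subset pair_finite_arcs by blast
qed

lemma nbrs_sym:
  assumes "pair_graph G"
  shows "w \<in> nbrs G v \<longleftrightarrow> v \<in> nbrs G w"
proof -
  interpret pair_graph G by fact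
  show ?thesis by (auto simp: nbrs_def dest: arcs_symmetric)
qed

lemma not_self_nbr:
  assumes "pair_graph G"
  shows "v \<notin> nbrs G v"
proof -
  interpret pair_graph G by fact
  show ?thesis by (auto simp: nbrs_def dest: pair_no_loops)
qed

lemma nbrs_subset_verts:
  assumes "pair_graph G"
  shows "nbrs G v \<subseteq> pverts G"
proof -
  interpret pair_graph G by fact
  show ?thesis by (auto simp: nbrs_def dest: arc_snd_in_verts)
qed

text \<open>Each vertex outside \<open>B\<close> loses at most one color for every neighbor in \<open>B\<close>, so its remaining
  colors outnumber its neighbors outside \<open>B\<close>.\<close>

lemma extend_proper_coloring:
  fixes c :: "'a \<Rightarrow> nat"
  assumes G: "pair_graph G" and reg: "regular G d"
    and range: "c ` B \<subseteq> {1..d + 1}"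
    and proper: "\<And>u v. u \<in> B \<Longrightarrow> v \<in> B \<Longrightarrow> v \<in> nbrs G u \<Longrightarrow> c u \<noteq> c v"
  obtains c' where "\<And>v. v \<in> B \<Longrightarrow> c' v = c v" "c' ` pverts G \<subseteq> {1..d + 1}" "proper_coloring G c'"
proof -
  let ?W = "pverts G - B"
  let ?P = "\<lambda>v. {1..d + 1} - c ` (nbrs G v \<inter> B)"
  have "card {w \<in> ?W. w \<in> nbrs G v} < card (?P v)" if v: "v \<in> ?W" for v
  proof -
    have fin: "finite (nbrs G v)" by (rule finite_nbrs[OF G])
    have eq: "{w \<in> ?W. w \<in> nbrs G v} = nbrs G v - B"
      using nbrs_subset_verts[OF G] by auto
    have "card (nbrs G v - B) + card (nbrs G v \<inter> B) = d"
      using v reg card_Diff_subset_Int[of "nbrs G v" B] card_mono[OF fin, of "nbrs G v \<inter> B"] fin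
      by (auto simp: regular_def)
    moreover have "card (c ` (nbrs G v \<inter> B)) \<le> card (nbrs G v \<inter> B)"
      using fin by (intro card_image_le) auto
    moreover have "card (?P v) \<ge> d + 1 - card (c ` (nbrs G v \<inter> B))"
      using diff_card_le_card_Diff[of "c ` (nbrs G v \<inter> B)" "{1..d + 1}"] fin by simp
    ultimately show ?thesis unfolding eq by linarith
  qed
  moreover have "finite ?W"
  proof -
    interpret pair_graph G by fact
    show ?thesis using pair_finite_verts by simp
  qed
  ultimately have "\<exists>f. (\<forall>v\<in>?W. f v \<in> ?P v) \<and>
      (\<forall>v\<in>?W. \<forall>w\<in>?W. w \<in> nbrs G v \<longrightarrow> f v \<noteq> f w)"
    using greedy_list_coloring[of ?W "\<lambda>v w. w \<in> nbrs G v" ?P] nbrs_sym[OF G] not_self_nbr[OF G]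
    by blast
  then obtain f where f: "\<And>v. v \<in> ?W \<Longrightarrow> f v \<in> ?P v"
    "\<And>v w. v \<in> ?W \<Longrightarrow> w \<in> ?W \<Longrightarrow> w \<in> nbrs G v \<Longrightarrow> f v \<noteq> f w"
    by blast
  have f_B: "f v \<noteq> c u" if "v \<in> ?W" "u \<in> B" "u \<in> nbrs G v" for u v
    using f(1)[OF that(1)] that(2,3) by blast
  let ?c = "\<lambda>v. if v \<in> B then c v else f v"
  show ?thesis
  proof (rule that[of ?c])
    show "?c ` pverts G \<subseteq> {1..d + 1}" using range f(1) by fastforce
    show "proper_coloring G ?c"
      unfolding proper_coloring_def
    proof (intro ballI)
      fix u v assume uv: "u \<in> pverts G" "v \<in> nbrs G u"
      then have "v \<in> pverts G" "u \<in> nbrs G v"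
        using nbrs_subset_verts[OF G] nbrs_sym[OF G] by blast+
      then show "?c u \<noteq> ?c v"
        using uv proper[of u v] f_B[of u v] f_B[of v u] f(2)[of u v] by auto
    qed
  qed simp
qed

section \<open>Coloring the branches\<close>

lemma extend_injection_to_bijection:
  assumes "finite S" "finite T" "card S = card T" "A \<subseteq> S" "inj_on f A" "f ` A \<subseteq> T"
  obtains g where "bij_betw g S T" "\<And>v. v \<in> A \<Longrightarrow> g v = f v"
proof -
  have "card (S - A) = card (T - f ` A)"
    using assms by (simp add: card_Diff_subset card_image finite_subset)
  then obtain h where h: "bij_betw h (S - A) (T - f ` A)"
    using finite_same_card_bij[of "S - A" "T - f ` A"] assms(1,2) by blast
  let ?g = "\<lambda>v. if v \<in> A then f v else h v"
  have "bij_betw ?g A (f ` A)"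
    using assms(5) by (simp add: bij_betw_def inj_on_def)
  moreover have "bij_betw ?g (S - A) (T - f ` A)"
    using h by (rule bij_betw_cong[THEN iffD1, rotated]) simp
  ultimately have "bij_betw ?g (A \<union> (S - A)) (f ` A \<union> (T - f ` A))"
    by (rule bij_betw_combine) auto
  moreover have "A \<union> (S - A) = S" "f ` A \<union> (T - f ` A) = T" using assms by auto
  ultimately show ?thesis using that[of ?g] by simp
qed

text \<open>Only the vertices with an edge to another branch are constrained from outside their branch.
  Among these vertices, each conflicts with at most \<open>m - 1\<close> of its own branch and \<open>m\<close> of other
  branches, which leaves a color because each branch has at least \<open>2 m\<close> of them.\<close>

lemma branch_coloring:
  fixes S :: "'i \<Rightarrow> 'a set" and T :: "'i \<Rightarrow> 'c set"
  assumes "finite I"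
    and fin: "\<And>i. i \<in> I \<Longrightarrow> finite (S i)" "\<And>i. i \<in> I \<Longrightarrow> finite (T i)"
    and card: "\<And>i. i \<in> I \<Longrightarrow> card (S i) = card (T i)" "\<And>i. i \<in> I \<Longrightarrow> 2 * m \<le> card (T i)"
    and disj: "\<And>i j v. i \<in> I \<Longrightarrow> j \<in> I \<Longrightarrow> v \<in> S i \<Longrightarrow> v \<in> S j \<Longrightarrow> i = j"
    and sym: "\<And>v w. E v w \<Longrightarrow> E w v"
    and few_crossing: "\<And>i. i \<in> I \<Longrightarrow> card {v \<in> S i. \<exists>w \<in> (\<Union>j\<in>I - {i}. S j). E v w} \<le> m"
    and few_cross_edges: "\<And>i v. i \<in> I \<Longrightarrow> v \<in> S i \<Longrightarrow> card {w \<in> (\<Union>j\<in>I - {i}. S j). E v w} \<le> m"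
  obtains f where "\<And>i. i \<in> I \<Longrightarrow> bij_betw f (S i) (T i)"
    "\<And>i j v w. i \<in> I \<Longrightarrow> j \<in> I \<Longrightarrow> i \<noteq> j \<Longrightarrow> v \<in> S i \<Longrightarrow> w \<in> S j \<Longrightarrow> E v w \<Longrightarrow> f v \<noteq> f w"
proof -
  define A where "A i = {v \<in> S i. \<exists>w \<in> (\<Union>j\<in>I - {i}. S j). E v w}" for i
  define h where "h v = (THE i. i \<in> I \<and> v \<in> S i)" for v
  have h: "h v = i" if "i \<in> I" "v \<in> S i" for i v
    unfolding h_def using that disj by blast
  have A_sub: "A i \<subseteq> S i" for i by (auto simp: A_def)
  have A_card: "card (A i) \<le> m" if "i \<in> I" for i
    using few_crossing[OF that] by (simp add: A_def)
  define W where "W = (\<Union>i\<in>I. A i)"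
  define R where "R v w \<longleftrightarrow> v \<noteq> w \<and> (h v = h w \<or> E v w)" for v w
  have "card {w \<in> W. R v w} < card (T (h v))" if "v \<in> W" for v
  proof -
    obtain i where i: "i \<in> I" "v \<in> A i" using \<open>v \<in> W\<close> by (auto simp: W_def)
    then have hv: "h v = i" using h A_sub by blast
    have finA: "finite (A i)" using i fin A_sub finite_subset by metis
    let ?C = "{w \<in> (\<Union>j\<in>I - {i}. S j). E v w}"
    have "{w \<in> W. R v w} \<subseteq> (A i - {v}) \<union> ?C"
    proof
      fix w assume w: "w \<in> {w \<in> W. R v w}"
      then obtain j where j: "j \<in> I" "w \<in> A j" by (auto simp: W_def)
      then have "w \<in> S j" "h w = j" using A_sub h by blast+
      then show "w \<in> (A i - {v}) \<union> ?C" using w j hv by (auto simp: R_def)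
    qed
    moreover have "finite ?C" using \<open>finite I\<close> fin(1) by auto
    ultimately have "card {w \<in> W. R v w} \<le> card ((A i - {v}) \<union> ?C)"
      using finA by (intro card_mono) auto
    also have "\<dots> \<le> card (A i - {v}) + card ?C" by (rule card_Un_le)
    also have "card (A i - {v}) < card (A i)"
      using i(2) finA by (rule card_Diff1_less[rotated])
    also have "card (A i) + card ?C \<le> m + m"
      using A_card[OF i(1)] few_cross_edges[OF i(1)] i(2) A_sub by (intro add_mono) auto
    also have "\<dots> \<le> card (T (h v))" using card(2)[OF i(1)] hv by simp
    finally show ?thesis by simp
  qed
  moreover have "finite W"
    unfolding W_def using \<open>finite I\<close> fin(1) A_sub by (meson finite_UN_I finite_subset)
  ultimately have "\<exists>f. (\<forall>v\<in>W. f v \<in> T (h v)) \<and> (\<forall>v\<in>W. \<forall>w\<in>W. R v w \<longrightarrow> f v \<noteq> f w)"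
    using sym by (intro greedy_list_coloring) (auto simp: R_def)
  then obtain f where f: "\<And>v. v \<in> W \<Longrightarrow> f v \<in> T (h v)"
    "\<And>v w. v \<in> W \<Longrightarrow> w \<in> W \<Longrightarrow> R v w \<Longrightarrow> f v \<noteq> f w"
    by blast
  have "\<exists>g. bij_betw g (S i) (T i) \<and> (\<forall>v\<in>A i. g v = f v)" if i: "i \<in> I" for i
  proof -
    have hA: "h v = i" if "v \<in> A i" for v using h[OF i] A_sub that by blast
    have "inj_on f (A i)"
    proof (rule inj_onI, rule ccontr)
      fix v w assume "v \<in> A i" "w \<in> A i" "f v = f w" "v \<noteq> w"
      then show False using f(2)[of v w] hA i by (auto simp: W_def R_def)
    qed
    moreover have "f ` A i \<subseteq> T i" using f(1) hA i by (fastforce simp: W_def)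
    ultimately show ?thesis
      using extend_injection_to_bijection[of "S i" "T i" "A i" f] fin card(1) A_sub i by metis
  qed
  then obtain g where g: "\<And>i. i \<in> I \<Longrightarrow> bij_betw (g i) (S i) (T i)"
    "\<And>i v. i \<in> I \<Longrightarrow> v \<in> A i \<Longrightarrow> g i v = f v"
    by metis
  show ?thesis
  proof (rule that[of "\<lambda>v. g (h v) v"])
    show "bij_betw (\<lambda>v. g (h v) v) (S i) (T i)" if "i \<in> I" for i
      using g(1)[OF that] by (rule bij_betw_cong[THEN iffD1, rotated]) (simp add: h[OF that])
  next
    fix i j v w assume *: "i \<in> I" "j \<in> I" "i \<noteq> j" "v \<in> S i" "w \<in> S j" "E v w"
    then have "v \<in> A i" "w \<in> A j" using sym by (auto simp: A_def)
    moreover from this have "f v \<noteq> f w"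
      using f(2)[of v w] * disj by (auto simp: W_def R_def)
    ultimately show "g (h v) v \<noteq> g (h w) w" using g(2) * h by simp
  qed
qed

section \<open>The b-chromatic number\<close>

lemma b_coloring_size_le:
  assumes G: "pair_graph G" and "regular G d" and "0 < k" and c: "b_coloring G k c"
  shows "k \<le> d + 1"
proof -
  have "1 \<in> {1..k}" using \<open>0 < k\<close> by simp
  then obtain v where v: "v \<in> pverts G" "c v = 1" "dominant G c v"
    using c unfolding b_coloring_def by blast
  have "\<exists>w\<in>nbrs G v. c w = j" if "j \<in> {2..k}" for j
  proof -
    have "j \<in> c ` pverts G - {c v}" using that v(2) c by (simp add: b_coloring_def)
    then show ?thesis using v(3) unfolding dominant_def by blast
  qed
  then have "{2..k} \<subseteq> c ` nbrs G v" by blast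
  then have "card {2..k} \<le> card (c ` nbrs G v)"
    by (intro card_mono finite_imageI finite_nbrs[OF G])
  also have "\<dots> \<le> card (nbrs G v)" by (intro card_image_le finite_nbrs[OF G])
  also have "\<dots> = d" using v(1) assms(2) by (simp add: regular_def)
  finally show ?thesis by simp
qed

lemma at_most_one_common_nbr:
  assumes G: "pair_graph G" and "\<not> has_4_cycle G"
    and "u \<in> nbrs G a" "u \<in> nbrs G b" "v \<in> nbrs G a" "v \<in> nbrs G b" "u \<noteq> v"
  shows "a = b"
proof (rule ccontr)
  assume "a \<noteq> b"
  moreover have "a \<noteq> u" "a \<noteq> v" "b \<noteq> u" "b \<noteq> v"
    using assms(3-6) not_self_nbr[OF G] by blast+
  ultimately have "distinct [a, u, b, v]" using assms(7) by auto
  moreover have "b \<in> nbrs G u" "a \<in> nbrs G v" using assms(3-6) nbrs_sym[OF G] by blast+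
  ultimately have "has_4_cycle G" unfolding has_4_cycle_iff[OF G] using assms(3,6) by blast
  with assms(2) show False by simp
qed

lemma twice_le_ceiling_half:
  fixes n d :: nat
  assumes "int n \<le> \<lceil>(real d - 1) / 2\<rceil> - 1"
  shows "2 * n + 2 \<le> d"
proof -
  have "real_of_int \<lceil>(real d - 1) / 2\<rceil> < (real d - 1) / 2 + 1" by linarith
  moreover have "real n \<le> real_of_int \<lceil>(real d - 1) / 2\<rceil> - 1" using assms by linarith
  ultimately have "real (2 * n + 2) < real (d + 1)" by (simp add: field_simps)
  then show ?thesis by linarith
qed

theorem theorem2p2:
  fixes G :: "'a pair_pre_digraph" and d :: nat and x :: 'a and xs :: "nat \<Rightarrow> 'a"
  assumes "pair_graph G"
    and "regular G d"
    and "d \<ge> 7"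
    and "\<not> has_4_cycle G"
    and "x \<in> pverts G"
    and "bij_betw xs {1..d} (nbrs G x)"
    and "\<And>i. i \<in> {1..d} \<Longrightarrow>
      int (card {v \<in> nbrs G (xs i). nbrs G v \<inter> (\<Union>j\<in>{1..d} - {i}. nbrs G (xs j)) \<noteq> {}})
        \<le> \<lceil>(real d - 1) / 2\<rceil> - 1"
    and "\<And>i v. i \<in> {1..d} \<Longrightarrow> v \<in> nbrs G (xs i) \<Longrightarrow>
      int (card (nbrs G v \<inter> (\<Union>j\<in>{1..d} - {i}. nbrs G (xs j))))
        \<le> \<lceil>(real d - 1) / 2\<rceil> - 1"
  shows "b_chromatic_number G = d + 1"
proof -
  note G = assms(1)
  note fin = finite_nbrs[OF G] and sym = nbrs_sym[OF G] and irrefl = not_self_nbr[OF G]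
  have xs_nbr: "xs i \<in> nbrs G x" if "i \<in> {1..d}" for i
    using assms(6) that by (auto simp: bij_betw_def)
  have x_nbr: "x \<in> nbrs G (xs i)" if "i \<in> {1..d}" for i
    using xs_nbr[OF that] sym by blast
  have xs_inj: "i = j" if "i \<in> {1..d}" "j \<in> {1..d}" "xs i = xs j" for i j
    using inj_onD[OF bij_betw_imp_inj_on[OF assms(6)]] that by blast
  have xs_surj: "\<exists>i\<in>{1..d}. xs i = v" if "v \<in> nbrs G x" for v
    using that unfolding bij_betw_imp_surj_on[OF assms(6), symmetric] by blast
  have xs_verts: "xs i \<in> pverts G" if "i \<in> {1..d}" for i
    using xs_nbr[OF that] nbrs_subset_verts[OF G] by blast
  have deg: "card (nbrs G (xs i)) = d" if "i \<in> {1..d}" for i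
    using xs_verts[OF that] assms(2) by (simp add: regular_def)
  define U where "U i = (\<Union>j\<in>{1..d} - {i}. nbrs G (xs j))" for i
  have crossing: "2 * card {v \<in> nbrs G (xs i). nbrs G v \<inter> U i \<noteq> {}} + 2 \<le> d"
    if "i \<in> {1..d}" for i
    unfolding U_def by (rule twice_le_ceiling_half[OF assms(7)[OF that]])
  have cross_edges: "2 * card (nbrs G v \<inter> U i) + 2 \<le> d"
    if "i \<in> {1..d}" "v \<in> nbrs G (xs i)" for i v
    unfolding U_def by (rule twice_le_ceiling_half[OF assms(8)[OF that]])
  have indep: "xs i \<notin> nbrs G (xs j)" if "i \<in> {1..d}" "j \<in> {1..d}" for i j
  proof
    assume adj: "xs i \<in> nbrs G (xs j)"
    then have "xs i \<in> U i" using that irrefl by (auto simp: U_def)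
    then have "{v \<in> nbrs G (xs i). nbrs G v \<inter> U i \<noteq> {}} = nbrs G (xs i)"
      using sym by blast
    then show False using crossing[OF that(1)] deg[OF that(1)] assms(3) by simp
  qed
  define S where "S i = nbrs G (xs i) - {x}" for i
  have S_disj: "i = j" if "i \<in> {1..d}" "j \<in> {1..d}" "v \<in> S i" "v \<in> S j" for i j v
  proof -
    have "xs i = xs j"
      using at_most_one_common_nbr[OF G assms(4), of v "xs i" "xs j" x] that
        x_nbr[OF that(1)] x_nbr[OF that(2)] unfolding S_def by blast
    then show ?thesis by (rule xs_inj[OF that(1,2)])
  qed
  have S_sub: "(\<Union>j\<in>{1..d} - {i}. S j) \<subseteq> U i" for i by (auto simp: S_def U_def)
  have finU: "finite (U i)" for i using fin by (auto simp: U_def)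
  obtain f where f_bij: "\<And>i. i \<in> {1..d} \<Longrightarrow> bij_betw f (S i) ({1..d} - {i})"
    and f_cross: "\<And>i j v w. i \<in> {1..d} \<Longrightarrow> j \<in> {1..d} \<Longrightarrow> i \<noteq> j \<Longrightarrow> v \<in> S i \<Longrightarrow> w \<in> S j
      \<Longrightarrow> w \<in> nbrs G v \<Longrightarrow> f v \<noteq> f w"
  proof (rule branch_coloring[of "{1..d}" S "\<lambda>i. {1..d} - {i}" "(d - 2) div 2" "\<lambda>v w. w \<in> nbrs G v"])
    fix i assume i: "i \<in> {1..d}"
    show "finite (S i)" using fin by (simp add: S_def)
    show "card (S i) = card ({1..d} - {i})" using i deg x_nbr by (simp add: S_def)
    show "2 * ((d - 2) div 2) \<le> card ({1..d} - {i})" using i by simp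
    have "card {v \<in> S i. \<exists>w \<in> (\<Union>j\<in>{1..d} - {i}. S j). w \<in> nbrs G v}
        \<le> card {v \<in> nbrs G (xs i). nbrs G v \<inter> U i \<noteq> {}}"
      using S_sub[of i] fin by (intro card_mono) (auto simp: S_def)
    then show "card {v \<in> S i. \<exists>w \<in> (\<Union>j\<in>{1..d} - {i}. S j). w \<in> nbrs G v} \<le> (d - 2) div 2"
      using crossing[OF i] by linarith
    fix v assume "v \<in> S i"
    have "card {w \<in> (\<Union>j\<in>{1..d} - {i}. S j). w \<in> nbrs G v} \<le> card (nbrs G v \<inter> U i)"
      using S_sub[of i] fin by (intro card_mono) auto
    then show "card {w \<in> (\<Union>j\<in>{1..d} - {i}. S j). w \<in> nbrs G v} \<le> (d - 2) div 2"
      using cross_edges[OF i, of v] \<open>v \<in> S i\<close> by (simp add: S_def)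
  next
    fix i j v assume "i \<in> {1..d}" "j \<in> {1..d}" "v \<in> S i" "v \<in> S j"
    then show "i = j" by (rule S_disj)
  next
    fix v w assume "w \<in> nbrs G v"
    then show "v \<in> nbrs G w" using sym by blast
  qed (auto intro: that)

  define c where "c v = (if v = x then d + 1 else if v \<in> nbrs G x then the_inv_into {1..d} xs v
    else f v)" for v
  have c_x: "c x = d + 1" by (simp add: c_def)
  have c_xs: "c (xs i) = i" if "i \<in> {1..d}" for i
    using that assms(6) xs_nbr[OF that] irrefl
    by (auto simp: c_def bij_betw_def the_inv_into_f_f)
  have c_S: "c v = f v" if "i \<in> {1..d}" "v \<in> S i" for i v
    using that indep xs_surj by (fastforce simp: c_def S_def)
  have f_range: "f v \<in> {1..d} - {i}" if "i \<in> {1..d}" "v \<in> S i" for i v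
    using bij_betwE[OF f_bij[OF that(1)]] that(2) by blast
  define B where "B = insert x (xs ` {1..d} \<union> (\<Union>i\<in>{1..d}. S i))"
  have proper: "c u \<noteq> c v" if "u \<in> B" "v \<in> B" "v \<in> nbrs G u" for u v
  proof -
    \<comment> \<open>By symmetry, it suffices to consider the edges leading away from \<open>x\<close> and those between
      vertices at distance 2 from \<open>x\<close>.\<close>
    have x_out: "c x \<noteq> c w" if "w \<in> nbrs G x" for w
      using xs_surj[OF that] c_x c_xs by fastforce
    have xs_out: "c (xs i) \<noteq> c w" if "i \<in> {1..d}" "w \<in> nbrs G (xs i)" for i w
    proof (cases "w = x")
      case True
      then show ?thesis using c_x c_xs[OF that(1)] that(1) by simp
    next
      case False
      then have "w \<in> S i" using that by (simp add: S_def)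
      then show ?thesis using f_range c_S c_xs that(1) by force
    qed
    have "c u \<noteq> c v" if ij: "i \<in> {1..d}" "u \<in> S i" "j \<in> {1..d}" "v \<in> S j" for i j
    proof (cases "i = j")
      case True
      have "u \<noteq> v" using \<open>v \<in> nbrs G u\<close> irrefl by blast
      then have "f u \<noteq> f v"
        using f_bij[OF ij(1)] ij True by (auto simp: bij_betw_def inj_on_def)
      then show ?thesis using c_S ij by metis
    next
      case False
      then show ?thesis using f_cross[of i j u v] c_S ij \<open>v \<in> nbrs G u\<close> by metis
    qed
    moreover have "u \<in> nbrs G v" using \<open>v \<in> nbrs G u\<close> sym by blast
    ultimately show ?thesis
      using that x_out[of u] x_out[of v] xs_out unfolding B_def by (auto dest: not_sym) metis+
  qed
  have "c ` B \<subseteq> {1..d + 1}"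
    using c_x c_xs c_S f_range by (fastforce simp: B_def)
  then obtain c' where c': "\<And>v. v \<in> B \<Longrightarrow> c' v = c v" "c' ` pverts G \<subseteq> {1..d + 1}"
    "proper_coloring G c'"
    using extend_proper_coloring[OF G assms(2), of c B] proper by metis
  have c'_x: "c' x = d + 1" using c' c_x by (simp add: B_def)
  have c'_xs: "c' (xs i) = i" if "i \<in> {1..d}" for i using c' c_xs that by (simp add: B_def)
  have c'_S: "c' v = f v" if "i \<in> {1..d}" "v \<in> S i" for i v
  proof -
    have "v \<in> B" using that unfolding B_def by blast
    then show ?thesis using c'(1) c_S[OF that] by simp
  qed
  have range: "c' ` pverts G = {1..d + 1}"
  proof
    show "{1..d + 1} \<subseteq> c' ` pverts G"
    proof
      fix i assume "i \<in> {1..d + 1}"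
      then consider "i = d + 1" | "i \<in> {1..d}" by fastforce
      then show "i \<in> c' ` pverts G"
        using c'_x c'_xs xs_verts assms(5) by cases (metis imageI)+
    qed
  qed (fact c'(2))
  have dom_x: "dominant G c' x"
    unfolding dominant_def range c'_x
  proof
    fix j assume "j \<in> {1..d + 1} - {d + 1}"
    then have "j \<in> {1..d}" by auto
    then show "\<exists>w\<in>nbrs G x. c' w = j" using c'_xs xs_nbr by blast
  qed
  have dom_xs: "dominant G c' (xs i)" if i: "i \<in> {1..d}" for i
    unfolding dominant_def range c'_xs[OF i]
  proof
    fix j assume j: "j \<in> {1..d + 1} - {i}"
    show "\<exists>w\<in>nbrs G (xs i). c' w = j"
    proof (cases "j = d + 1")
      case True
      then show ?thesis using c'_x x_nbr[OF i] by blast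
    next
      case False
      then have "j \<in> f ` S i" using f_bij[OF i] j by (auto simp: bij_betw_def)
      then show ?thesis using c'_S[OF i] by (force simp: S_def)
    qed
  qed
  have "\<exists>v\<in>pverts G. c' v = i \<and> dominant G c' v" if "i \<in> {1..d + 1}" for i
  proof -
    from that consider "i = d + 1" | "i \<in> {1..d}" by fastforce
    then show ?thesis
      using dom_x c'_x assms(5) dom_xs c'_xs xs_verts by cases blast+
  qed
  then have "b_coloring G (d + 1) c'" using range c'(3) by (simp add: b_coloring_def)
  then show ?thesis
    unfolding b_chromatic_number_def
    using b_coloring_size_le[OF G assms(2)] finite_b_coloring_sizes[OF G]
    by (intro Max_eqI) auto
qed

end
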